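(* Let $I$ be a set, $\alpha : I \to I$ and $G : \mathcal{P}_{\omega,*}(I) \to \mathcal{P}_{\omega,*}(I)$. Then the following conditions are equivalent: 1. $\forall I^* \in \mathcal{P}_{\omega,*}(I) : I^* \subseteq G(I^* )$ and $\alpha(G(I^* )) \subseteq G(I^* )$. 2. All the orbits $\mathcal{O}^+_\alpha(a)$, $a \in I$, are finite and there exists $H : \mathcal{P}_{\omega,*}(I) \to \mathcal{P}_{\omega}(I)$ such that $$\forall I^* \in \mathcal{P}_{\omega,*}(I) : G(I^* ) = \bigcup_{a \in I^* \cup H(I^* )} \mathcal{O}^+_\alpha(a).$$
   Context: $\mathcal{P}_{\omega}(I)$ is the set of finite subsets of $I$, and $\mathcal{P}_{\omega,*}(I)$ is the set of finite non-empty subsets of $I$. For a self-map $\phi : I \to I$ and $a \in I$, $\mathcal{O}^+_\phi(a) = \{\phi^n(a) : n \in \mathbb{N}\}$ is the forward orbit of $a$, where $\mathbb{N} = \{0,1,2,\dots\}$ and $\phi^0 = \mathrm{Id}$. *)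

theory Defs
  imports Main "HOL-Library.FuncSet"
begin

abbreviation nonempty_Fpow :: "'a set \<Rightarrow> 'a set set" where
  "nonempty_Fpow I \<equiv> Fpow I - {{}}"

(* The orbit starts at n = 0, so a itself always belongs to it; the constant orbit of
   HOL-Combinatorics.Orbits starts at n = 1 instead. *)
definition forward_orbit :: "('a \<Rightarrow> 'a) \<Rightarrow> 'a \<Rightarrow> 'a set" where
  "forward_orbit \<phi> a = {(\<phi> ^^ n) a | n :: nat. True}"

end

(* A set mapped into itself by \<alpha> contains the orbits of its points, hence is the union of
   them. So condition 1 gives condition 2 with H = G. *)
theory Submission
  imports Defs
begin

text \<open>The forward orbit of \<open>a\<close> is the least set containing \<open>a\<close> and
  mapped into itself by the map; the three lemmas below say exactly this. Minimality turns an
  invariant \<open>G J\<close> into the union of the orbits of its points, and bounds the orbit of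
  \<open>a\<close> by the finite set \<open>G {a}\<close>. Conversely, containing the base points
  and being invariant both pass from single orbits to unions of orbits.\<close>

lemma self_mem_forward_orbit: "a \<in> forward_orbit \<phi> a"
  unfolding forward_orbit_def by (auto intro: exI[of _ 0])

lemma image_forward_orbit_subset: "\<phi> ` forward_orbit \<phi> a \<subseteq> forward_orbit \<phi> a"
proof
  fix y assume "y \<in> \<phi> ` forward_orbit \<phi> a"
  then obtain n where "y = (\<phi> ^^ Suc n) a"
    unfolding forward_orbit_def by auto
  then show "y \<in> forward_orbit \<phi> a"
    unfolding forward_orbit_def by blast
qed

text \<open>Minimality of the orbit: by induction on \<open>n\<close>, no iterate of
  \<open>a\<close> leaves an invariant set.\<close>

lemma forward_orbit_subset:
  assumes "\<phi> ` S \<subseteq> S" and "a \<in> S"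
  shows "forward_orbit \<phi> a \<subseteq> S"
proof -
  have "(\<phi> ^^ n) a \<in> S" for n
    using assms by (induction n) auto
  then show ?thesis
    unfolding forward_orbit_def by blast
qed

theorem proposition6p1:
  fixes I :: "'a set"
    and \<alpha> :: "'a \<Rightarrow> 'a"
    and G :: "'a set \<Rightarrow> 'a set"
  assumes "\<alpha> \<in> I \<rightarrow> I"
    and "G \<in> nonempty_Fpow I \<rightarrow> nonempty_Fpow I"
  shows "(\<forall>J \<in> nonempty_Fpow I. J \<subseteq> G J \<and> \<alpha> ` G J \<subseteq> G J) \<longleftrightarrow>
    ((\<forall>a \<in> I. finite (forward_orbit \<alpha> a)) \<and>
     (\<exists>H \<in> nonempty_Fpow I \<rightarrow> Fpow I.
        \<forall>J \<in> nonempty_Fpow I. G J = (\<Union>a \<in> J \<union> H J. forward_orbit \<alpha> a)))"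
    (is "?invariant \<longleftrightarrow> ?finite \<and> ?union")
proof
  assume inv: ?invariant
  have orbits: "forward_orbit \<alpha> a \<subseteq> G J" if "J \<in> nonempty_Fpow I" "a \<in> G J" for J a
    using inv that by (intro forward_orbit_subset) auto
  have ?finite
  proof
    fix a assume "a \<in> I"
    \<comment> \<open>Evaluating \<open>G\<close> at the singleton gives a finite invariant set
      through \<open>a\<close>.\<close>
    then have J: "{a} \<in> nonempty_Fpow I"
      by (simp add: Fpow_def)
    then have "forward_orbit \<alpha> a \<subseteq> G {a}"
      using inv by (intro orbits) auto
    moreover have "finite (G {a})"
      using J assms(2) by (auto simp: Fpow_def)
    ultimately show "finite (forward_orbit \<alpha> a)"
      by (rule finite_subset)
  qed
  \<comment> \<open>The witness is \<open>H = G\<close>: since \<open>J\<close> lies inside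
    \<open>G J\<close>, the index set collapses to \<open>G J\<close>.\<close>
  moreover have "G J = (\<Union>a \<in> J \<union> G J. forward_orbit \<alpha> a)" if J: "J \<in> nonempty_Fpow I" for J
  proof -
    have "J \<union> G J = G J"
      using inv J by blast
    moreover have "(\<Union>a \<in> G J. forward_orbit \<alpha> a) = G J"
    proof
      show "(\<Union>a \<in> G J. forward_orbit \<alpha> a) \<subseteq> G J"
        using orbits[OF J] by (rule UN_least)
      show "G J \<subseteq> (\<Union>a \<in> G J. forward_orbit \<alpha> a)"
        by (auto intro: self_mem_forward_orbit)
    qed
    ultimately show ?thesis
      by simp
  qed
  moreover have "G \<in> nonempty_Fpow I \<rightarrow> Fpow I"
    using assms(2) by blast
  ultimately show "?finite \<and> ?union"
    by blast
next
  assume "?finite \<and> ?union"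
  then obtain H where H: "\<forall>J \<in> nonempty_Fpow I. G J = (\<Union>a \<in> J \<union> H J. forward_orbit \<alpha> a)"
    by blast
  show ?invariant
  proof
    fix J assume "J \<in> nonempty_Fpow I"
    with H have G: "G J = (\<Union>a \<in> J \<union> H J. forward_orbit \<alpha> a)"
      by blast
    show "J \<subseteq> G J \<and> \<alpha> ` G J \<subseteq> G J"
    proof
      show "J \<subseteq> G J"
        unfolding G by (auto intro: self_mem_forward_orbit)
      show "\<alpha> ` G J \<subseteq> G J"
        \<comment> \<open>Images commute with unions, so invariance is checked one orbit at a
          time.\<close>
        unfolding G image_UN by (intro UN_mono order_refl image_forward_orbit_subset)
    qed
  qed
qed

end
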